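(* Let $X,Y,Z$ be random functions on a common probability scheme $(\Omega,\mathrm{pr})$. Then $X$ and $Y$ are conditionally independent given $Z$ if and only if the natural injection $$[\langle X,Y,Z\rangle]\longrightarrow[\langle X,Z\rangle]\otimes_{[Z]}[\langle Y,Z\rangle],\qquad \langle x,y,z\rangle\mapsto\langle\langle x,z\rangle,\langle y,z\rangle\rangle,$$ is an isomorphism of schemes.
   Context: A (probability) scheme is a finite set $\Omega$ with a function $\mathrm{pr}\colon\Omega\to(0,\infty)$ such that $\sum_{\omega}\mathrm{pr}(\omega)=1$. A random function is a function (with values in any set) defined on a scheme. The distribution scheme $[X]$ of a random function $X$ on $(\Omega,\mathrm{pr})$ is the set $X(\Omega)$ with distribution $x\mapsto\Pr(X=x)$; $\langle X,Y,\ldots\rangle$ denotes the tuple-valued random function. A bundle is a map of schemes preserving probabilities of events under preimage; an isomorphism of schemes is a bijection of the underlying sets preserving the point probabilities. For bundles $\pi_1\colon(\Omega_1,\mathrm{pr}_1)\to(\Omega_0,\mathrm{pr}_0)$ and $\pi_2\colon(\Omega_2,\mathrm{pr}_2)\to(\Omega_0,\mathrm{pr}_0)$, the fiber product $\Omega_1\otimes_{\Omega_0}\Omega_2$ is the scheme on $\{\langle\omega_1,\omega_2\rangle:\pi_1(\omega_1)=\pi_2(\omega_2)\}$ with distribution $\langle\omega_1,\omega_2\rangle\mapsto\mathrm{pr}_1(\omega_1)\mathrm{pr}_2(\omega_2)/\mathrm{pr}_0(\pi_1(\omega_1))$. The bundles $[\langle X,Z\rangle]\to[Z]$ and $[\langle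 Y,Z\rangle]\to[Z]$ are the projections to the $Z$-coordinate. $X$ and $Y$ are conditionally independent given $Z$ if $\Pr(X=x,Y=y|Z=z)=\Pr(X=x|Z=z)\Pr(Y=y|Z=z)$ for all $x\in X(\Omega)$, $y\in Y(\Omega)$, $z\in Z(\Omega)$. *)

theory Defs
  imports "HOL-Probability.Probability"
begin

text \<open>
  A finite set \<open>\<Omega>\<close> with strictly positive weights summing to \<open>1\<close> is represented by the \<^typ>\<open>'a pmf\<close>
  whose support \<^const>\<open>set_pmf\<close> is \<open>\<Omega>\<close> and whose point probabilities are given by \<^const>\<open>pmf\<close>;
  positivity on the support and total mass \<open>1\<close> hold by construction.

  A random function on \<open>p\<close> is a HOL function, of which only the values on \<open>set_pmf p\<close> matter; its
  set of values is \<open>X ` set_pmf p\<close>, and its distribution scheme \<open>[X]\<close> is \<open>map_pmf X p\<close>.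
\<close>

definition scheme :: "'a pmf \<Rightarrow> bool" where
  "scheme p \<longleftrightarrow> finite (set_pmf p)"

definition scheme_bundle :: "('a \<Rightarrow> 'b) \<Rightarrow> 'a pmf \<Rightarrow> 'b pmf \<Rightarrow> bool" where
  "scheme_bundle \<pi> p q \<longleftrightarrow> scheme p \<and> scheme q \<and> \<pi> ` set_pmf p \<subseteq> set_pmf q \<and>
     (\<forall>A\<subseteq>set_pmf q. measure_pmf.prob p {\<omega>\<in>set_pmf p. \<pi> \<omega> \<in> A} = measure_pmf.prob q A)"

definition scheme_iso :: "('a \<Rightarrow> 'b) \<Rightarrow> 'a pmf \<Rightarrow> 'b pmf \<Rightarrow> bool" where
  "scheme_iso f p q \<longleftrightarrow> scheme p \<and> scheme q \<and> bij_betw f (set_pmf p) (set_pmf q) \<and>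
     (\<forall>\<omega>\<in>set_pmf p. pmf q (f \<omega>) = pmf p \<omega>)"

text \<open>
  \<^const>\<open>embed_pmf\<close> is meaningful only if the given weights are nonnegative with total mass \<open>1\<close>; for
  bundles this is \<open>pmf_fiber_product\<close> below. Pairs outside \<open>set_pmf p\<^sub>1 \<times> set_pmf p\<^sub>2\<close> get weight \<open>0\<close>,
  so the support is as expected (\<open>set_pmf_fiber_product\<close>).
\<close>

definition fiber_product ::
  "'a pmf \<Rightarrow> ('a \<Rightarrow> 'c) \<Rightarrow> 'b pmf \<Rightarrow> ('b \<Rightarrow> 'c) \<Rightarrow> 'c pmf \<Rightarrow> ('a \<times> 'b) pmf" where
  "fiber_product p\<^sub>1 \<pi>\<^sub>1 p\<^sub>2 \<pi>\<^sub>2 p\<^sub>0 = embed_pmf (\<lambda>(\<omega>\<^sub>1, \<omega>\<^sub>2).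
     if \<pi>\<^sub>1 \<omega>\<^sub>1 = \<pi>\<^sub>2 \<omega>\<^sub>2 then pmf p\<^sub>1 \<omega>\<^sub>1 * pmf p\<^sub>2 \<omega>\<^sub>2 / pmf p\<^sub>0 (\<pi>\<^sub>1 \<omega>\<^sub>1) else 0)"

definition cond_indep :: "'a pmf \<Rightarrow> ('a \<Rightarrow> 'x) \<Rightarrow> ('a \<Rightarrow> 'y) \<Rightarrow> ('a \<Rightarrow> 'z) \<Rightarrow> bool" where
  "cond_indep p X Y Z \<longleftrightarrow>
     (\<forall>x\<in>X ` set_pmf p. \<forall>y\<in>Y ` set_pmf p. \<forall>z\<in>Z ` set_pmf p.
        \<P>(\<omega> in measure_pmf p. X \<omega> = x \<and> Y \<omega> = y \<bar> Z \<omega> = z) =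
        \<P>(\<omega> in measure_pmf p. X \<omega> = x \<bar> Z \<omega> = z) * \<P>(\<omega> in measure_pmf p. Y \<omega> = y \<bar> Z \<omega> = z))"

lemma scheme_map_pmf: "scheme p \<Longrightarrow> scheme (map_pmf X p)"
  by (simp add: scheme_def)

lemma pmf_distribution_scheme: "pmf (map_pmf X p) x = \<P>(\<omega> in measure_pmf p. X \<omega> = x)"
  by (simp add: pmf_map vimage_def)

lemma scheme_bundle_pmf:
  assumes "scheme_bundle \<pi> p q" "y \<in> set_pmf q"
  shows "(\<Sum>\<omega>\<in>{\<omega>\<in>set_pmf p. \<pi> \<omega> = y}. pmf p \<omega>) = pmf q y"
proof -
  have "measure_pmf.prob p {\<omega>\<in>set_pmf p. \<pi> \<omega> \<in> {y}} = measure_pmf.prob q {y}"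
    using assms unfolding scheme_bundle_def by blast
  moreover have "finite {\<omega>\<in>set_pmf p. \<pi> \<omega> = y}"
    using assms by (simp add: scheme_bundle_def scheme_def)
  ultimately show ?thesis
    by (simp add: measure_measure_pmf_finite measure_pmf_single)
qed

lemma pmf_fiber_product:
  assumes "scheme_bundle \<pi>\<^sub>1 p\<^sub>1 p\<^sub>0" "scheme_bundle \<pi>\<^sub>2 p\<^sub>2 p\<^sub>0"
  shows "pmf (fiber_product p\<^sub>1 \<pi>\<^sub>1 p\<^sub>2 \<pi>\<^sub>2 p\<^sub>0) (\<omega>\<^sub>1, \<omega>\<^sub>2) =
    (if \<pi>\<^sub>1 \<omega>\<^sub>1 = \<pi>\<^sub>2 \<omega>\<^sub>2 then pmf p\<^sub>1 \<omega>\<^sub>1 * pmf p\<^sub>2 \<omega>\<^sub>2 / pmf p\<^sub>0 (\<pi>\<^sub>1 \<omega>\<^sub>1) else 0)"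
proof -
  define f where "f = (\<lambda>(\<omega>\<^sub>1, \<omega>\<^sub>2).
     if \<pi>\<^sub>1 \<omega>\<^sub>1 = \<pi>\<^sub>2 \<omega>\<^sub>2 then pmf p\<^sub>1 \<omega>\<^sub>1 * pmf p\<^sub>2 \<omega>\<^sub>2 / pmf p\<^sub>0 (\<pi>\<^sub>1 \<omega>\<^sub>1) else 0)"
  have fin: "finite (set_pmf p\<^sub>1)" "finite (set_pmf p\<^sub>2)"
    using assms by (auto simp: scheme_bundle_def scheme_def)
  have nn: "f x \<ge> 0" for x
    by (auto simp: f_def split: prod.splits)
  have inner: "(\<Sum>b\<in>set_pmf p\<^sub>2. f (a, b)) = pmf p\<^sub>1 a" if a: "a \<in> set_pmf p\<^sub>1" for a
  proof -
    have \<pi>a: "\<pi>\<^sub>1 a \<in> set_pmf p\<^sub>0" using assms(1) a by (auto simp: scheme_bundle_def)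
    have "(\<Sum>b\<in>set_pmf p\<^sub>2. f (a, b)) =
        (\<Sum>b\<in>{b\<in>set_pmf p\<^sub>2. \<pi>\<^sub>2 b = \<pi>\<^sub>1 a}. pmf p\<^sub>1 a / pmf p\<^sub>0 (\<pi>\<^sub>1 a) * pmf p\<^sub>2 b)"
      using fin by (subst sum.inter_filter) (auto simp: f_def intro!: sum.cong)
    also have "\<dots> = pmf p\<^sub>1 a / pmf p\<^sub>0 (\<pi>\<^sub>1 a) * pmf p\<^sub>0 (\<pi>\<^sub>1 a)"
      using scheme_bundle_pmf[OF assms(2) \<pi>a] by (simp only: sum_distrib_left[symmetric])
    also have "\<dots> = pmf p\<^sub>1 a" using \<pi>a by (simp add: set_pmf_iff)
    finally show ?thesis .
  qed
  have "(\<integral>\<^sup>+x. ennreal (f x) \<partial>count_space UNIV) = (\<Sum>x\<in>set_pmf p\<^sub>1 \<times> set_pmf p\<^sub>2. ennreal (f x))"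
    using fin by (intro nn_integral_count_space') (auto simp: f_def set_pmf_iff split: if_splits)
  also have "\<dots> = ennreal (\<Sum>x\<in>set_pmf p\<^sub>1 \<times> set_pmf p\<^sub>2. f x)"
    using nn by (simp add: sum_ennreal)
  also have "(\<Sum>x\<in>set_pmf p\<^sub>1 \<times> set_pmf p\<^sub>2. f x) = (\<Sum>a\<in>set_pmf p\<^sub>1. \<Sum>b\<in>set_pmf p\<^sub>2. f (a, b))"
    by (simp add: sum.cartesian_product)
  also have "\<dots> = 1"
    using inner fin sum_pmf_eq_1[of "set_pmf p\<^sub>1" p\<^sub>1] by simp
  finally have "(\<integral>\<^sup>+x. ennreal (f x) \<partial>count_space UNIV) = 1" by simp
  then have "pmf (embed_pmf f) (\<omega>\<^sub>1, \<omega>\<^sub>2) = f (\<omega>\<^sub>1, \<omega>\<^sub>2)"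
    using nn by (intro pmf_embed_pmf)
  then show ?thesis by (simp add: fiber_product_def f_def)
qed

lemma set_pmf_fiber_product:
  assumes "scheme_bundle \<pi>\<^sub>1 p\<^sub>1 p\<^sub>0" "scheme_bundle \<pi>\<^sub>2 p\<^sub>2 p\<^sub>0"
  shows "set_pmf (fiber_product p\<^sub>1 \<pi>\<^sub>1 p\<^sub>2 \<pi>\<^sub>2 p\<^sub>0) =
    {(\<omega>\<^sub>1, \<omega>\<^sub>2) \<in> set_pmf p\<^sub>1 \<times> set_pmf p\<^sub>2. \<pi>\<^sub>1 \<omega>\<^sub>1 = \<pi>\<^sub>2 \<omega>\<^sub>2}"
proof -
  have "pmf p\<^sub>0 (\<pi>\<^sub>1 a) \<noteq> 0" if "pmf p\<^sub>1 a \<noteq> 0" for a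
    using assms(1) that unfolding scheme_bundle_def set_pmf_iff[symmetric] by blast
  then have "\<pi>\<^sub>1 a = \<pi>\<^sub>2 b \<Longrightarrow> pmf p\<^sub>1 a \<noteq> 0 \<Longrightarrow> pmf p\<^sub>0 (\<pi>\<^sub>2 b) \<noteq> 0" for a b
    by metis
  then show ?thesis
    by (auto simp: set_pmf_iff pmf_fiber_product[OF assms] split: if_splits)
qed

lemma scheme_fiber_product:
  assumes "scheme_bundle \<pi>\<^sub>1 p\<^sub>1 p\<^sub>0" "scheme_bundle \<pi>\<^sub>2 p\<^sub>2 p\<^sub>0"
  shows "scheme (fiber_product p\<^sub>1 \<pi>\<^sub>1 p\<^sub>2 \<pi>\<^sub>2 p\<^sub>0)"
proof -
  have "finite (set_pmf p\<^sub>1 \<times> set_pmf p\<^sub>2)"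
    using assms by (simp add: scheme_bundle_def scheme_def)
  then show ?thesis
    unfolding scheme_def set_pmf_fiber_product[OF assms] by (rule rev_finite_subset) auto
qed

lemma scheme_bundle_map_pmf:
  assumes "scheme p"
  shows "scheme_bundle \<pi> p (map_pmf \<pi> p)"
proof -
  have "measure_pmf.prob p {\<omega>\<in>set_pmf p. \<pi> \<omega> \<in> A} = measure_pmf.prob p (\<pi> -` A)" for A
    by (rule measure_pmf.finite_measure_eq_AE) (auto simp: AE_measure_pmf_iff)
  with assms show ?thesis
    by (simp add: scheme_bundle_def scheme_def)
qed

lemma scheme_bundle_snd:
  assumes "scheme p"
  shows "scheme_bundle snd (map_pmf (\<lambda>\<omega>. (X \<omega>, Z \<omega>)) p) (map_pmf Z p)"
proof -
  have "map_pmf Z p = map_pmf snd (map_pmf (\<lambda>\<omega>. (X \<omega>, Z \<omega>)) p)"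
    by (simp add: pmf.map_comp comp_def)
  then show ?thesis
    using scheme_bundle_map_pmf[of "map_pmf (\<lambda>\<omega>. (X \<omega>, Z \<omega>)) p" snd] assms
    by (simp add: scheme_map_pmf)
qed

text \<open>The triple \<open>\<langle>x, y, z\<rangle>\<close> is the HOL tuple \<open>(x, y, z)\<close>, that is, \<open>(x, (y, z))\<close>.\<close>

definition natural_map :: "'x \<times> 'y \<times> 'z \<Rightarrow> ('x \<times> 'z) \<times> ('y \<times> 'z)" where
  "natural_map = (\<lambda>(x, y, z). ((x, z), (y, z)))"

lemma natural_map_injection:
  assumes "scheme p"
  shows "inj_on natural_map (set_pmf (map_pmf (\<lambda>\<omega>. (X \<omega>, Y \<omega>, Z \<omega>)) p))"
    and "natural_map ` set_pmf (map_pmf (\<lambda>\<omega>. (X \<omega>, Y \<omega>, Z \<omega>)) p) \<subseteq>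
      set_pmf (fiber_product (map_pmf (\<lambda>\<omega>. (X \<omega>, Z \<omega>)) p) snd
        (map_pmf (\<lambda>\<omega>. (Y \<omega>, Z \<omega>)) p) snd (map_pmf Z p))"
  using assms
  by (auto simp: inj_on_def natural_map_def set_pmf_fiber_product[OF scheme_bundle_snd scheme_bundle_snd])

end

theory Submission
  imports Defs
begin

text \<open>
  Both sides say that
  \<open>Pr(X = x, Y = y, Z = z) = Pr(X = x, Z = z) Pr(Y = y, Z = z) / Pr(Z = z)\<close>
  for all \<open>x\<close>, \<open>y\<close>, \<open>z\<close>. Where one of \<open>x\<close>, \<open>y\<close>, \<open>z\<close> is not a value, this holds because both sides
  vanish; where all of them are values, it is conditional independence multiplied by \<open>Pr(Z = z)\<close>.
  For the fibre product, equality of the point probabilities at all triples, not only at those of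
  positive probability, forces the supports to correspond, hence surjectivity.
\<close>

text \<open>Trades bijectivity for an identity of weights at every point, zero weights included, so
  that supports need not be compared separately.\<close>

lemma scheme_iso_iff_pmf_eq:
  assumes "scheme p" "scheme q" "inj f" "set_pmf q \<subseteq> range f"
  shows "scheme_iso f p q \<longleftrightarrow> (\<forall>\<omega>. pmf q (f \<omega>) = pmf p \<omega>)"
proof
  assume iso: "scheme_iso f p q"
  show "\<forall>\<omega>. pmf q (f \<omega>) = pmf p \<omega>"
  proof
    fix \<omega>
    show "pmf q (f \<omega>) = pmf p \<omega>"
    proof (cases "\<omega> \<in> set_pmf p")
      case False
      \<comment> \<open>\<open>set_pmf q\<close> is the image of \<open>set_pmf p\<close>;
        injectivity off the support keeps \<open>f \<omega>\<close> out of it.\<close>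
      with iso \<open>inj f\<close> have "f \<omega> \<notin> set_pmf q"
        by (metis scheme_iso_def bij_betw_imp_surj_on inj_image_mem_iff)
      with False show ?thesis by (simp add: set_pmf_iff)
    qed (use iso in \<open>simp add: scheme_iso_def\<close>)
  qed
next
  assume eq: "\<forall>\<omega>. pmf q (f \<omega>) = pmf p \<omega>"
  then have "\<omega> \<in> set_pmf p \<longleftrightarrow> f \<omega> \<in> set_pmf q" for \<omega>
    by (simp add: set_pmf_iff)
  with assms(4) have "f ` set_pmf p = set_pmf q" by blast
  with assms eq show "scheme_iso f p q"
    by (auto simp: scheme_iso_def bij_betw_def intro: inj_on_subset)
qed

lemma cond_indep_iff_pmf_eq:
  "cond_indep p X Y Z \<longleftrightarrow>
    (\<forall>x y z. pmf (map_pmf (\<lambda>\<omega>. (X \<omega>, Y \<omega>, Z \<omega>)) p) (x, y, z) =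
      pmf (map_pmf (\<lambda>\<omega>. (X \<omega>, Z \<omega>)) p) (x, z) * pmf (map_pmf (\<lambda>\<omega>. (Y \<omega>, Z \<omega>)) p) (y, z) /
      pmf (map_pmf Z p) z)"
  (is "_ \<longleftrightarrow> (\<forall>x y z. ?T x y z = ?A x z * ?B y z / ?C z)")
proof -
  \<comment> \<open>Bracketed as in the numerator of \<open>cond_prob\<close>.\<close>
  have T: "?T x y z = measure_pmf.prob p {\<omega>. (X \<omega> = x \<and> Y \<omega> = y) \<and> Z \<omega> = z}" for x y z
    by (simp add: pmf_distribution_scheme conj_assoc)
  have A: "?A x z = measure_pmf.prob p {\<omega>. X \<omega> = x \<and> Z \<omega> = z}" for x z
    by (simp add: pmf_distribution_scheme)
  have B: "?B y z = measure_pmf.prob p {\<omega>. Y \<omega> = y \<and> Z \<omega> = z}" for y z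
    by (simp add: pmf_distribution_scheme)
  have C: "?C z = measure_pmf.prob p {\<omega>. Z \<omega> = z}" for z
    by (simp add: pmf_distribution_scheme)
  have on_values: "?T x y z = ?A x z * ?B y z / ?C z \<longleftrightarrow>
      ?T x y z / ?C z = ?A x z / ?C z * (?B y z / ?C z)" if "z \<in> Z ` set_pmf p" for x y z
  proof -
    have "?C z \<noteq> 0" using that by (simp add: set_pmf_iff[symmetric])
    then show ?thesis by (simp add: field_simps)
  qed
  \<comment> \<open>If \<open>z\<close> is not a value, the right side is 0 / 0, which is 0 in
    HOL.\<close>
  have off_values: "?T x y z = ?A x z * ?B y z / ?C z"
    if "\<not> (x \<in> X ` set_pmf p \<and> y \<in> Y ` set_pmf p \<and> z \<in> Z ` set_pmf p)" for x y z
  proof -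
    have "?T x y z = 0" "?A x z = 0 \<or> ?B y z = 0 \<or> ?C z = 0"
      using that by (auto simp: pmf_eq_0_set_pmf)
    then show ?thesis by auto
  qed
  have "cond_indep p X Y Z \<longleftrightarrow>
      (\<forall>x\<in>X ` set_pmf p. \<forall>y\<in>Y ` set_pmf p. \<forall>z\<in>Z ` set_pmf p.
        ?T x y z / ?C z = ?A x z / ?C z * (?B y z / ?C z))"
    unfolding cond_indep_def cond_prob_def T A B C by simp
  also have "\<dots> \<longleftrightarrow> (\<forall>x y z. ?T x y z = ?A x z * ?B y z / ?C z)"
    using on_values off_values by (smt (verit, ccfv_threshold))
  finally show ?thesis .
qed

theorem proposition9:
  fixes p :: "'a pmf"
    and X :: "'a \<Rightarrow> 'x" and Y :: "'a \<Rightarrow> 'y" and Z :: "'a \<Rightarrow> 'z"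
  assumes "scheme p"
  shows "cond_indep p X Y Z \<longleftrightarrow>
    scheme_iso natural_map
      (map_pmf (\<lambda>\<omega>. (X \<omega>, Y \<omega>, Z \<omega>)) p)
      (fiber_product (map_pmf (\<lambda>\<omega>. (X \<omega>, Z \<omega>)) p) snd
                     (map_pmf (\<lambda>\<omega>. (Y \<omega>, Z \<omega>)) p) snd
                     (map_pmf Z p))"
  (is "_ \<longleftrightarrow> scheme_iso natural_map ?P ?Q")
proof -
  note bundles = scheme_bundle_snd[OF assms, of X Z] scheme_bundle_snd[OF assms, of Y Z]
  have "inj (natural_map :: 'x \<times> 'y \<times> 'z \<Rightarrow> _)"
    by (auto simp: inj_def natural_map_def)
  \<comment> \<open>Paired points share their \<open>snd\<close>, so they have the form
    \<open>((x, z), (y, z))\<close>.\<close>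
  moreover have "set_pmf ?Q \<subseteq> range natural_map"
    by (auto simp: set_pmf_fiber_product[OF bundles] natural_map_def image_iff)
  ultimately have "scheme_iso natural_map ?P ?Q \<longleftrightarrow> (\<forall>\<omega>. pmf ?Q (natural_map \<omega>) = pmf ?P \<omega>)"
    by (intro scheme_iso_iff_pmf_eq scheme_map_pmf scheme_fiber_product[OF bundles] assms)
  \<comment> \<open>On the range of \<open>natural_map\<close> the \<open>snd\<close> components
    agree, so the weight in \<open>?Q\<close> is the quotient, never the default 0.\<close>
  then show ?thesis
    by (auto simp: natural_map_def pmf_fiber_product[OF bundles] cond_indep_iff_pmf_eq)
qed

end
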